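(* In the group of isometries of the Euclidean plane, any relation among reflections in lines is a corollary of the pencil relations and the involution relations. That is, if $l_1,\dots,l_n$ are lines of the Euclidean plane with $R_{l_1}\circ R_{l_2}\circ\dots\circ R_{l_n}=\mathrm{id}$, then this relation is a consequence of pencil relations and involution relations.
   Context: For a line $l$ in the Euclidean plane, $R_l$ denotes the reflection in $l$. A pencil of lines is either the set of all lines parallel to a given line (coinciding lines count as parallel) or the set of all lines passing through a given point. A pencil relation is an equality $R_m\circ R_l=R_{m'}\circ R_{l'}$ that holds in the isometry group, where the lines $l,m,l',m'$ belong to one pencil. An involution relation is an equality $R_l^2=\mathrm{id}$, where $l$ is a line. A relation $R_{l_1}\circ\dots\circ R_{l_n}=\mathrm{id}$ is a corollary (consequence) of the pencil and involution relations if, in the free group on the set of symbols $\{r_l\}$ indexed by all lines $l$, the word $r_{l_1}r_{l_2}\cdots r_{l_n}$ lies in the normal closure of the set of all elements $r_l^2$ and all elements $r_m r_l (r_{m'}r_{l'})^{-1}$ corresponding to involution and pencil relations. *)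

theory Defs
  imports "HOL-Analysis.Analysis" "HOL-Algebra.Coset" "HOL-Algebra.Generated_Groups"
begin

section \<open>Free groups and normal closures\<close>

text \<open>
  The letter \<open>(True, x)\<close> stands for the generator \<open>x\<close> and \<open>(False, x)\<close> for its formal inverse.
\<close>

inductive cancel :: "'a set \<Rightarrow> (bool \<times> 'a) list \<Rightarrow> (bool \<times> 'a) list \<Rightarrow> bool"
  for A where
  "x \<in> A \<Longrightarrow> cancel A (u @ (s, x) # (\<not> s, x) # v) (u @ v)"

definition free_words :: "'a set \<Rightarrow> (bool \<times> 'a) list set" where
  "free_words A = lists (UNIV \<times> A)"

definition free_rel :: "'a set \<Rightarrow> ((bool \<times> 'a) list \<times> (bool \<times> 'a) list) set" where
  "free_rel A = {(u, v). u \<in> free_words A \<and> v \<in> free_words A \<and> equivclp (cancel A) u v}"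

definition free_group :: "'a set \<Rightarrow> (bool \<times> 'a) list set monoid" where
  "free_group A =
    \<lparr>carrier = free_words A // free_rel A,
     mult = (\<lambda>X Y. \<Union>u\<in>X. \<Union>v\<in>Y. free_rel A `` {u @ v}),
     one = free_rel A `` {[]}\<rparr>"

definition free_gen :: "'a set \<Rightarrow> 'a \<Rightarrow> (bool \<times> 'a) list set" where
  "free_gen A x = free_rel A `` {[(True, x)]}"

definition normal_closure :: "('g, 'm) monoid_scheme \<Rightarrow> 'g set \<Rightarrow> 'g set" where
  "normal_closure G S = \<Inter>{N. N \<lhd> G \<and> S \<subseteq> N}"

lemma free_words_simps [simp]:
  "[] \<in> free_words A"
  "a # u \<in> free_words A \<longleftrightarrow> snd a \<in> A \<and> u \<in> free_words A"
  "u @ v \<in> free_words A \<longleftrightarrow> u \<in> free_words A \<and> v \<in> free_words A"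
  by (cases a; auto simp: free_words_def)+

lemma equiv_free_rel: "equiv (free_words A) (free_rel A)"
  by (rule equivI) (auto simp: free_rel_def refl_on_def sym_def trans_def
      intro: equivclp_sym equivclp_trans)

lemma cancel_append:
  assumes "cancel A u v"
  shows "cancel A (w @ u) (w @ v)" "cancel A (u @ w) (v @ w)"
  using assms cancel.intros[of _ A "w @ _"] cancel.intros[of _ A _ _ "_ @ w"]
  by (auto elim!: cancel.cases)

lemma equivclp_cancel_append:
  assumes "equivclp (cancel A) u v"
  shows "equivclp (cancel A) (w @ u) (w @ v) \<and> equivclp (cancel A) (u @ w) (v @ w)"
  using assms
proof (induction rule: equivclp_induct)
  case (step y z)
  then show ?case
    by (meson cancel_append equivclp_into_equivclp)
qed simp

lemma free_rel_append:
  assumes "(u, u') \<in> free_rel A" "(v, v') \<in> free_rel A"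
  shows "(u @ v, u' @ v') \<in> free_rel A"
  using assms equivclp_cancel_append[of A u u' v] equivclp_cancel_append[of A v v' u']
  by (auto simp: free_rel_def intro: equivclp_trans)

lemma free_group_mult:
  assumes "u \<in> free_words A" "v \<in> free_words A"
  shows "free_rel A `` {u} \<otimes>\<^bsub>free_group A\<^esub> free_rel A `` {v} = free_rel A `` {u @ v}"
proof -
  have "congruent2 (free_rel A) (free_rel A) (\<lambda>u v. free_rel A `` {u @ v})"
    unfolding congruent2_def by (auto intro!: equiv_class_eq[OF equiv_free_rel] free_rel_append)
  then show ?thesis
    using UN_equiv_class2[OF equiv_free_rel equiv_free_rel] assms
    by (simp add: free_group_def)
qed

lemma free_words_cancel:
  assumes "u \<in> free_words A"
  shows "(map (\<lambda>(s, x). (\<not> s, x)) (rev u) @ u, []) \<in> free_rel A"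
  using assms
proof (induction u)
  case Nil
  then show ?case by (simp add: free_rel_def)
next
  case (Cons a u)
  obtain s x where a: "a = (s, x)" by force
  let ?i = "map (\<lambda>(s, x). (\<not> s, x)) (rev u)"
  have x: "x \<in> A" and u: "u \<in> free_words A" using Cons.prems a by auto
  have "cancel A (?i @ (\<not> s, x) # (\<not> \<not> s, x) # u) (?i @ u)"
    by (rule cancel.intros[OF x])
  then have "equivclp (cancel A) (?i @ (\<not> s, x) # (s, x) # u) (?i @ u)"
    by auto
  moreover have "?i @ u \<in> free_words A" "equivclp (cancel A) (?i @ u) []"
    using Cons.IH[OF u] by (auto simp: free_rel_def)
  ultimately show ?case
    using x by (auto simp: free_rel_def a intro: equivclp_trans)
qed

lemma free_group_carrierE:
  assumes "X \<in> carrier (free_group A)"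
  obtains u where "u \<in> free_words A" "X = free_rel A `` {u}"
  using assms unfolding free_group_def by (auto elim!: quotientE)

lemma free_group_carrierI: "u \<in> free_words A \<Longrightarrow> free_rel A `` {u} \<in> carrier (free_group A)"
  by (simp add: free_group_def quotientI)

lemma free_group_one: "\<one>\<^bsub>free_group A\<^esub> = free_rel A `` {[]}"
  by (simp add: free_group_def)

lemma group_free_group: "group (free_group A)"
proof (rule groupI)
  fix X assume "X \<in> carrier (free_group A)"
  then obtain u where u: "u \<in> free_words A" "X = free_rel A `` {u}"
    by (rule free_group_carrierE)
  let ?i = "map (\<lambda>(s, x). (\<not> s, x)) (rev u)"
  have i: "?i \<in> free_words A" using u(1) by (auto simp: free_words_def in_lists_conv_set)
  have "free_rel A `` {?i @ u} = free_rel A `` {[]}"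
    by (rule equiv_class_eq[OF equiv_free_rel free_words_cancel[OF u(1)]])
  then show "\<exists>Y\<in>carrier (free_group A). Y \<otimes>\<^bsub>free_group A\<^esub> X = \<one>\<^bsub>free_group A\<^esub>"
    using free_group_carrierI[OF i] free_group_mult[OF i u(1)] u(2) free_group_one by metis
qed (auto elim!: free_group_carrierE simp: free_group_mult free_group_one
      intro!: free_group_carrierI)

text \<open>The universal property of \<^const>\<open>free_group\<close>:\<close>

lemma free_gen_closed: "x \<in> A \<Longrightarrow> free_gen A x \<in> carrier (free_group A)"
  by (simp add: free_gen_def free_group_carrierI)

lemma free_group_extend:
  assumes "group H" and f: "f \<in> A \<rightarrow> carrier H"
  shows "\<exists>h\<in>hom (free_group A) H. \<forall>x\<in>A. h (free_gen A x) = f x"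
proof -
  interpret H: group H by fact
  define g where "g = (\<lambda>x. if x \<in> A then f x else \<one>\<^bsub>H\<^esub>)"
  have g: "g x \<in> carrier H" for x using f by (auto simp: g_def)
  define l where "l = (\<lambda>(s, x). if s then g x else inv\<^bsub>H\<^esub> g x)"
  have l: "l a \<in> carrier H" for a using g by (auto simp: l_def split: prod.split)
  define e where "e = rec_list \<one>\<^bsub>H\<^esub> (\<lambda>a _ r. l a \<otimes>\<^bsub>H\<^esub> r)"
  have e_simps [simp]: "e [] = \<one>\<^bsub>H\<^esub>" "e (a # u) = l a \<otimes>\<^bsub>H\<^esub> e u" for a u
    by (simp_all add: e_def)
  have e [simp]: "e u \<in> carrier H" for u by (induction u) (auto simp: l)
  have app: "e (u @ v) = e u \<otimes>\<^bsub>H\<^esub> e v" for u v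
    by (induction u) (auto simp: l H.m_assoc)
  have ll: "l (s, x) \<otimes>\<^bsub>H\<^esub> (l (\<not> s, x) \<otimes>\<^bsub>H\<^esub> r) = r" if "r \<in> carrier H" for s x r
    using that g by (cases s) (simp_all add: l_def H.m_assoc[symmetric])
  have step: "e u = e v" if "cancel A u v" for u v
    using that by cases (simp add: app ll)
  have "e u = e v" if "equivclp (cancel A) u v" for u v
    using that by (induction rule: equivclp_induct) (auto dest: step)
  then have resp: "congruent (free_rel A) (\<lambda>u. {e u})"
    by (auto simp: congruent_def free_rel_def)
  define h where "h = (\<lambda>X. the_elem (\<Union>u\<in>X. {e u}))"
  have h: "h (free_rel A `` {u}) = e u" if "u \<in> free_words A" for u
    using UN_equiv_class[OF equiv_free_rel resp that] by (simp add: h_def)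
  have "h \<in> hom (free_group A) H"
    by (auto simp: hom_def h free_group_mult app elim!: free_group_carrierE)
  moreover have "h (free_gen A x) = f x" if "x \<in> A" for x
    using that g[of x] h[of "[(True, x)]"] by (auto simp: free_gen_def l_def g_def)
  ultimately show ?thesis by blast
qed

lemma free_group_generated: "generate (free_group A) (free_gen A ` A) = carrier (free_group A)"
proof
  interpret group "free_group A" by (rule group_free_group)
  show "generate (free_group A) (free_gen A ` A) \<subseteq> carrier (free_group A)"
    by (rule generate_incl) (auto intro: free_gen_closed)
  have "free_rel A `` {u} \<in> generate (free_group A) (free_gen A ` A)" if "u \<in> free_words A" for u
    using that
  proof (induction u)
    case Nil
    then show ?case using generate.one[of "free_group A"] by (simp add: free_group_one)
  next
    case (Cons a u)
    obtain s x where a: "a = (s, x)" by force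
    have x: "x \<in> A" and u: "u \<in> free_words A" using Cons.prems a by auto
    have "free_rel A `` {[(False, x)]} \<otimes>\<^bsub>free_group A\<^esub> free_gen A x = \<one>\<^bsub>free_group A\<^esub>"
      using x free_words_cancel[of "[(True, x)]" A]
      by (simp add: free_gen_def free_group_mult free_group_one equiv_class_eq[OF equiv_free_rel])
    then have "free_rel A `` {[(False, x)]} = inv\<^bsub>free_group A\<^esub> free_gen A x"
      using x by (intro inv_equality[symmetric]) (auto intro: free_gen_closed free_group_carrierI)
    moreover have "free_gen A x \<in> free_gen A ` A"
      using x by blast
    ultimately have "free_rel A `` {[a]} \<in> generate (free_group A) (free_gen A ` A)"
      by (cases s) (metis a free_gen_def generate.incl, metis a generate.inv)
    from generate.eng[OF this Cons.IH[OF u]] show ?case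
      using free_group_mult[of "[a]" A u] u x a by simp
  qed
  then show "carrier (free_group A) \<subseteq> generate (free_group A) (free_gen A ` A)"
    by (auto elim!: free_group_carrierE)
qed

section \<open>Lines, reflections and relations\<close>

type_synonym plane = "real ^ 2"

definition lines :: "plane set set" where
  "lines = {l. affine l \<and> aff_dim l = 1}"

text \<open>For a line \<open>l\<close>, \<^term>\<open>closest_point l x\<close> is the foot of the perpendicular from \<open>x\<close> to \<open>l\<close>.\<close>

definition reflection :: "plane set \<Rightarrow> plane \<Rightarrow> plane" where
  "reflection l x = 2 *\<^sub>R closest_point l x - x"

definition pencil :: "plane set set \<Rightarrow> bool" where
  "pencil P \<longleftrightarrow> (\<exists>k\<in>lines. P = {l \<in> lines. affine_parallel k l}) \<or> (\<exists>p. P = {l \<in> lines. p \<in> l})"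

abbreviation line_group :: "(bool \<times> plane set) list set monoid" where
  "line_group \<equiv> free_group lines"

abbreviation sym_of :: "plane set \<Rightarrow> (bool \<times> plane set) list set" where
  "sym_of l \<equiv> free_gen lines l"

definition involution_relators :: "(bool \<times> plane set) list set set" where
  "involution_relators = {sym_of l \<otimes>\<^bsub>line_group\<^esub> sym_of l | l. l \<in> lines}"

definition pencil_relators :: "(bool \<times> plane set) list set set" where
  "pencil_relators =
    {(sym_of m \<otimes>\<^bsub>line_group\<^esub> sym_of l) \<otimes>\<^bsub>line_group\<^esub>
       inv\<^bsub>line_group\<^esub> (sym_of m' \<otimes>\<^bsub>line_group\<^esub> sym_of l') | l m l' m'.
     (\<exists>P. pencil P \<and> {l, m, l', m'} \<subseteq> P) \<and>
     reflection m \<circ> reflection l = reflection m' \<circ> reflection l'}"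

definition word_of :: "plane set list \<Rightarrow> (bool \<times> plane set) list set" where
  "word_of ls = foldr (\<lambda>l w. sym_of l \<otimes>\<^bsub>line_group\<^esub> w) ls \<one>\<^bsub>line_group\<^esub>"

end

theory Submission
  imports Defs
begin

text \<open>
  The three reflections theorem says that \<open>R\<^sub>a R\<^sub>b\<close>, for lines of a pencil, can be rewritten by a pencil
  relation so that its first or its second factor is any prescribed line of the pencil. If pencils
  containing \<open>a, b\<close> and \<open>c, d\<close> share a line \<open>e\<close>, this turns \<open>a b c d\<close> into \<open>x e e y\<close> and hence
  into \<open>x y\<close>. Two pencils fail to share a line only if they are parallel pencils of different
  directions, and then rewriting \<open>b c\<close> first makes the lines meet. So every word reduces to
  length two or three. A product of three reflections is never the identity, and
  \<open>R\<^sub>a R\<^sub>b = id\<close> forces \<open>a = b\<close>, which is an involution relation.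
\<close>

section \<open>Mirrors\<close>

definition normal_vec :: "real \<Rightarrow> plane" where
  "normal_vec t = vector [cos t, sin t]"

text \<open>Lines are encoded by the angle \<open>t\<close> of a unit normal and a signed offset
  \<open>k\<close>. A fixed \<open>t\<close> gives a parallel pencil, and
  \<open>k = normal_vec t \<bullet> p\<close> gives the lines through \<open>p\<close>. The pair is
  not unique: turning the normal by pi and negating \<open>k\<close> gives the same line.\<close>

definition mirror :: "real \<Rightarrow> real \<Rightarrow> plane set" where
  "mirror t k = {x. normal_vec t \<bullet> x = k}"

lemma mem_mirror_iff: "x \<in> mirror t k \<longleftrightarrow> normal_vec t \<bullet> x = k"
  by (simp add: mirror_def)

lemma inner_normal_vec: "normal_vec t \<bullet> x = cos t * x $ 1 + sin t * x $ 2"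
  by (simp add: normal_vec_def inner_vec_def sum_2)

lemma normal_vec_nth [simp]: "normal_vec t $ 1 = cos t" "normal_vec t $ 2 = sin t"
  by (simp_all add: normal_vec_def)

lemma inner_normal_vec_self [simp]: "normal_vec t \<bullet> normal_vec t = 1"
  using sin_cos_squared_add3 by (simp add: inner_normal_vec)

lemma norm_normal_vec [simp]: "norm (normal_vec t) = 1"
  by (simp add: norm_eq_1)

lemma normal_vec_nonzero [simp]: "normal_vec t \<noteq> 0"
  using norm_normal_vec[of t] by (metis norm_zero zero_neq_one)

lemma mirror_in_lines [simp]: "mirror t k \<in> lines"
  by (simp add: lines_def mirror_def affine_hyperplane aff_dim_hyperplane)

lemma normal_vec_exists:
  assumes "norm (a :: plane) = 1"
  obtains t where "a = normal_vec t"
proof -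
  have "(a $ 1)\<^sup>2 + (a $ 2)\<^sup>2 = 1"
    using assms by (simp add: norm_eq_1 inner_vec_def sum_2 power2_eq_square)
  then obtain t where "a $ 1 = cos t" "a $ 2 = sin t"
    using sincos_total_2pi by metis
  then have "a = normal_vec t"
    by (simp add: vec_eq_iff forall_2)
  then show thesis by (rule that)
qed

text \<open>In dimension two a line is a hyperplane; dividing its equation by the norm of the normal
  leaves a unit normal, which has an angle.\<close>

lemma lines_mirrorE:
  assumes "l \<in> lines"
  obtains t k where "l = mirror t k"
proof -
  have "affine hull l = l" "aff_dim l = int (DIM(plane) - 1)"
    using assms by (auto simp: lines_def affine_hull_eq)
  then obtain a b where a: "a \<noteq> 0" and l: "l = {x. a \<bullet> x = b}"
    using aff_dim_eq_hyperplane[of l] by metis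
  obtain t where t: "a /\<^sub>R norm a = normal_vec t"
    by (rule normal_vec_exists[of "a /\<^sub>R norm a"]) (use a in auto)
  have "a \<bullet> x = b \<longleftrightarrow> normal_vec t \<bullet> x = b / norm a" for x
    using a by (simp flip: t add: field_simps)
  then have "l = mirror t (b / norm a)"
    by (simp add: l mirror_def)
  then show thesis by (rule that)
qed

section \<open>Reflections in coordinates\<close>

lemma reflection_mirror:
  "reflection (mirror t k) x = x - (2 * (normal_vec t \<bullet> x - k)) *\<^sub>R normal_vec t"
proof -
  let ?z = "x - (normal_vec t \<bullet> x - k) *\<^sub>R normal_vec t"
  have foot: "closest_point (mirror t k) x = ?z"
  proof (rule closest_point_unique[symmetric])
    show "convex (mirror t k)" "closed (mirror t k)"
      by (simp_all add: mirror_def convex_hyperplane closed_hyperplane)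
    show "?z \<in> mirror t k"
      by (simp add: mirror_def inner_diff_right)
    show "\<forall>y\<in>mirror t k. dist x ?z \<le> dist x y"
    proof
      fix y assume "y \<in> mirror t k"
      then have "normal_vec t \<bullet> x - k = normal_vec t \<bullet> (x - y)"
        by (simp add: mirror_def inner_diff_right)
      \<comment> \<open>Since the normal is a unit vector, the left side is the absolute value of
        \<open>normal_vec t \<bullet> (x - y)\<close>, and Cauchy-Schwarz bounds it.\<close>
      then show "dist x ?z \<le> dist x y"
        using Cauchy_Schwarz_ineq2[of "normal_vec t" "x - y"] by (simp add: dist_norm)
    qed
  qed
  show ?thesis
    unfolding reflection_def foot by (simp add: vec_eq_iff algebra_simps)
qed

lemma reflection_reflection [simp]:
  "l \<in> lines \<Longrightarrow> reflection l (reflection l x) = x"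
  by (elim lines_mirrorE)
     (simp add: reflection_mirror inner_diff_right algebra_simps)

lemma reflection_involution: "l \<in> lines \<Longrightarrow> reflection l \<circ> reflection l = id"
  by (simp add: fun_eq_iff)

lemma reflection_eq_self_iff: "l \<in> lines \<Longrightarrow> reflection l x = x \<longleftrightarrow> x \<in> l"
  by (erule lines_mirrorE) (simp add: reflection_mirror, auto simp: mirror_def)

lemma reflection_neq_id:
  assumes "l \<in> lines"
  shows "reflection l \<noteq> id"
proof
  assume "reflection l = id"
  then have "l = UNIV"
    using reflection_eq_self_iff[OF assms] by auto
  then show False
    using assms by (simp add: lines_def)
qed

lemma reflection_inj:
  assumes "a \<in> lines" "b \<in> lines" "reflection a = reflection b"
  shows "a = b"
  using reflection_eq_self_iff[OF assms(1)] reflection_eq_self_iff[OF assms(2)] assms(3) by auto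

text \<open>The line is the perpendicular bisector of \<open>p\<close> and its image, so this pair
  determines it. With \<open>c\<close> and \<open>?d\<close> the signed distances of
  \<open>p\<close> and \<open>x\<close> from the line, the squared distances differ by
  \<open>4 * c * ?d\<close>.\<close>

lemma mem_line_iff_dist:
  assumes "l \<in> lines" "reflection l p \<noteq> p"
  shows "x \<in> l \<longleftrightarrow> dist x p = dist x (reflection l p)"
proof -
  obtain t k where l: "l = mirror t k"
    using assms(1) by (rule lines_mirrorE)
  define c where "c = normal_vec t \<bullet> p - k"
  have c: "c \<noteq> 0"
    using assms(2) by (auto simp: l reflection_mirror c_def)
  let ?d = "normal_vec t \<bullet> x - k"
  have "x - reflection l p = (x - p) + (2 * c) *\<^sub>R normal_vec t"
    by (simp add: l reflection_mirror c_def algebra_simps)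
  then have "(dist x (reflection l p))\<^sup>2 =
      (norm ((x - p) + (2 * c) *\<^sub>R normal_vec t))\<^sup>2"
    by (simp only: dist_norm)
  also have "\<dots> = (dist x p)\<^sup>2 + 4 * c * (normal_vec t \<bullet> (x - p)) + 4 * c\<^sup>2"
    unfolding dist_norm power2_norm_eq_inner inner_add_left inner_add_right
    by (simp add: inner_commute power2_eq_square)
  also have "\<dots> = (dist x p)\<^sup>2 + 4 * c * ?d"
    by (simp add: c_def inner_diff_right algebra_simps power2_eq_square)
  finally have "(dist x (reflection l p))\<^sup>2 = (dist x p)\<^sup>2 \<longleftrightarrow> ?d = 0"
    using c by simp
  moreover have "(dist x (reflection l p))\<^sup>2 = (dist x p)\<^sup>2 \<longleftrightarrow> dist x p = dist x (reflection l p)"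
    by (auto simp: power2_eq_iff_nonneg)
  ultimately show ?thesis
    by (auto simp: l mirror_def)
qed

text \<open>If \<open>a\<close> and \<open>b\<close> both move a point \<open>p\<close> of \<open>c\<close>, they are the perpendicular bisector of
  \<open>p\<close> and its common image; if they fix every such \<open>p\<close>, both equal \<open>c\<close>.\<close>

lemma reflection_comp_neq_reflection:
  assumes "a \<in> lines" "b \<in> lines" "c \<in> lines"
  shows "reflection a \<circ> reflection b \<noteq> reflection c"
proof
  assume eq: "reflection a \<circ> reflection b = reflection c"
  \<comment> \<open>A point \<open>p\<close> of \<open>c\<close> is fixed by the product; applying
    the reflection in \<open>a\<close> once more separates the factors.\<close>
  have img: "reflection b p = reflection a p" if "p \<in> c" for p
    using fun_cong[OF eq, of p] reflection_eq_self_iff[OF assms(3), of p] that assms(1)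
    by (metis comp_apply reflection_reflection)
  \<comment> \<open>Otherwise the reflection in \<open>c\<close> would be the identity.\<close>
  have "a \<noteq> b"
    using eq reflection_involution assms reflection_neq_id by metis
  have fixed: "reflection a p = p" if "p \<in> c" for p
  proof (rule ccontr)
    assume "reflection a p \<noteq> p"
    then have "x \<in> a \<longleftrightarrow> x \<in> b" for x
      using img[OF that] mem_line_iff_dist[OF assms(1), of p x]
        mem_line_iff_dist[OF assms(2), of p x] by simp
    then show False
      using \<open>a \<noteq> b\<close> by blast
  qed
  then have "c \<subseteq> a" "c \<subseteq> b"
    using img fixed reflection_eq_self_iff assms by auto
  moreover have "c \<noteq> {}"
    using assms(3) by (auto simp: lines_def)
  ultimately have "c = a" "c = b"
    using assms affine_dim_equal[of c a] affine_dim_equal[of c b]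
    by (auto simp: lines_def)
  then show False
    using \<open>a \<noteq> b\<close> by simp
qed

section \<open>Pencils\<close>

lemma pencil_subset_lines: "pencil P \<Longrightarrow> P \<subseteq> lines"
  by (auto simp: pencil_def)

lemma parallel_mirrorE:
  assumes "affine_parallel (mirror t k) l"
  obtains j where "l = mirror t j"
proof -
  obtain v where v: "l = (\<lambda>x. v + x) ` mirror t k"
    using assms by (auto simp: affine_parallel_def)
  have "x \<in> l \<longleftrightarrow> x - v \<in> mirror t k" for x
    unfolding v by (metis (no_types, lifting) add_diff_cancel_left' add_diff_eq image_iff)
  then have "x \<in> l \<longleftrightarrow> x \<in> mirror t (k + normal_vec t \<bullet> v)" for x
    by (simp add: mirror_def inner_diff_right diff_eq_eq)
  then have "l = mirror t (k + normal_vec t \<bullet> v)"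
    by blast
  then show thesis by (rule that)
qed

lemma mirror_parallel: "affine_parallel (mirror t k) (mirror t j)"
  unfolding affine_parallel_def
proof
  let ?v = "(j - k) *\<^sub>R normal_vec t"
  show "mirror t j = (\<lambda>x. ?v + x) ` mirror t k"
  proof (intro equalityI subsetI)
    fix x assume "x \<in> mirror t j"
    then have "x - ?v \<in> mirror t k" "x = ?v + (x - ?v)"
      by (simp_all add: mirror_def inner_diff_right)
    then show "x \<in> (\<lambda>x. ?v + x) ` mirror t k"
      by blast
  qed (auto simp: mirror_def inner_add_right)
qed

lemma affine_parallel_mirror_iff: "affine_parallel (mirror t k) l \<longleftrightarrow> l \<in> range (mirror t)"
proof
  assume "affine_parallel (mirror t k) l"
  then obtain j where "l = mirror t j"
    by (rule parallel_mirrorE)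
  then show "l \<in> range (mirror t)"
    by simp
next
  assume "l \<in> range (mirror t)"
  then show "affine_parallel (mirror t k) l"
    using mirror_parallel by (elim rangeE) simp
qed

text \<open>Being parallel to a given line constrains only the angle, so the chosen base line
  disappears from the description.\<close>

lemma pencil_cases:
  assumes "pencil P"
  obtains (parallel) t where "P = range (mirror t)"
    | (concurrent) p where "P = {l \<in> lines. p \<in> l}"
proof -
  have "\<exists>t. P = range (mirror t)"
    if k: "k \<in> lines" and P: "P = {l \<in> lines. affine_parallel k l}" for k
  proof -
    obtain t j where "k = mirror t j"
      using k by (rule lines_mirrorE)
    then have "P = range (mirror t)"
      unfolding P by (auto simp: affine_parallel_mirror_iff)
    then show ?thesis ..
  qed
  then show thesis
    using assms that by (auto simp: pencil_def)
qed

lemma pencil_parallel: "pencil (range (mirror t))"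
proof -
  have "range (mirror t) = {l \<in> lines. affine_parallel (mirror t 0) l}"
    by (auto simp: affine_parallel_mirror_iff)
  then show ?thesis
    unfolding pencil_def using mirror_in_lines by blast
qed

lemma pencil_concurrent: "pencil {l \<in> lines. p \<in> l}"
  by (auto simp: pencil_def)

section \<open>Meeting and parallel lines\<close>

lemma mirror_meet_or_parallel:
  obtains p where "p \<in> mirror t k" "p \<in> mirror s j" | i where "mirror s j = mirror t i"
proof (cases "sin (s - t) = 0")
  case False
  \<comment> \<open>\<open>D\<close> is the determinant of the two normals, equal to
    \<open>sin (s - t)\<close>, and \<open>q\<close> holds the numerators of Cramer's rule.\<close>
  define D where "D = cos t * sin s - sin t * cos s"
  have D: "D \<noteq> 0"
    using False by (simp add: D_def sin_diff mult.commute)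
  define q :: plane where "q = vector [k * sin s - j * sin t, j * cos t - k * cos s]"
  have "normal_vec t \<bullet> q = k * D" "normal_vec s \<bullet> q = j * D"
    by (simp_all add: inner_normal_vec q_def D_def algebra_simps)
  then have "q /\<^sub>R D \<in> mirror t k" "q /\<^sub>R D \<in> mirror s j"
    using D by (simp_all add: mirror_def)
  then show thesis by (rule that)
next
  case True
  \<comment> \<open>This is 1 or -1: the normals agree up to sign, and the offset picks up the same
    sign.\<close>
  let ?c = "cos (s - t)"
  have c: "?c * ?c = 1"
    using True sin_cos_squared_add3[of "s - t"] by simp
  have "normal_vec s = ?c *\<^sub>R normal_vec t"
    using cos_add[of "s - t" t] sin_add[of "s - t" t] True
    by (simp add: vec_eq_iff forall_2)
  then have "normal_vec s \<bullet> x = j \<longleftrightarrow> normal_vec t \<bullet> x = ?c * j" for x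
    using c by (metis inner_scaleR_left mult.assoc mult_1)
  then have "mirror s j = mirror t (?c * j)"
    by (simp add: mirror_def)
  then show thesis by (rule that)
qed

lemma lines_meet_or_parallel:
  assumes "a \<in> lines" "b \<in> lines"
  obtains (meet) p where "p \<in> a" "p \<in> b"
    | (parallel) t where "a \<in> range (mirror t)" "b \<in> range (mirror t)"
proof -
  obtain t k where "a = mirror t k"
    using assms(1) by (rule lines_mirrorE)
  moreover obtain s j where "b = mirror s j"
    using assms(2) by (rule lines_mirrorE)
  ultimately show thesis
    using mirror_meet_or_parallel[of t k s j] that by (metis rangeI)
qed

lemma two_lines_in_pencil:
  assumes "a \<in> lines" "b \<in> lines"
  obtains P where "pencil P" "a \<in> P" "b \<in> P"
  using assms
proof (cases rule: lines_meet_or_parallel)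
  case (meet p)
  then have "a \<in> {l \<in> lines. p \<in> l}" "b \<in> {l \<in> lines. p \<in> l}"
    using assms by auto
  then show ?thesis
    by (rule that[OF pencil_concurrent])
next
  case (parallel t)
  then show ?thesis
    by (rule that[OF pencil_parallel])
qed

text \<open>It follows that the concurrent pencil at \<open>p\<close> shares a line with every
  pencil. In the pencil at \<open>q\<close> the joining line of \<open>p\<close> and
  \<open>q\<close> serves, or any line through \<open>p\<close> if they coincide.\<close>

lemma pencil_through:
  assumes "pencil P"
  obtains l where "l \<in> P" "p \<in> l"
  using assms
proof (cases rule: pencil_cases)
  case (parallel t)
  have "mirror t (normal_vec t \<bullet> p) \<in> P" "p \<in> mirror t (normal_vec t \<bullet> p)"
    by (auto simp: parallel mirror_def)
  then show ?thesis by (rule that)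
next
  case (concurrent q)
  have "\<exists>l\<in>lines. p \<in> l \<and> q \<in> l"
  proof (cases "p = q")
    case True
    have "p \<in> mirror 0 (normal_vec 0 \<bullet> p)"
      by (simp add: mirror_def)
    then show ?thesis
      using True mirror_in_lines by blast
  next
    case False
    then have "affine hull {p, q} \<in> lines"
      by (simp add: lines_def aff_dim_2)
    moreover have "p \<in> affine hull {p, q}" "q \<in> affine hull {p, q}"
      by (auto intro: hull_inc)
    ultimately show ?thesis by blast
  qed
  then show ?thesis
    using that concurrent by blast
qed

section \<open>Products of two reflections in a pencil\<close>

text \<open>The right-hand side is the rotation about \<open>p\<close> through
  \<open>2 * (t - s)\<close>, so only the difference of the angles matters.\<close>

lemma mirror_concurrent_comp:
  "reflection (mirror t (normal_vec t \<bullet> p)) (reflection (mirror s (normal_vec s \<bullet> p)) x) =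
    p + vector [cos (2 * (t - s)) * (x - p) $ 1 - sin (2 * (t - s)) * (x - p) $ 2,
                sin (2 * (t - s)) * (x - p) $ 1 + cos (2 * (t - s)) * (x - p) $ 2]"
proof -
  \<comment> \<open>The signs are those of a reflection matrix in which \<open>r\<close> is the
    angle of the normal rather than of the line itself.\<close>
  have R: "reflection (mirror r (normal_vec r \<bullet> p)) y =
      p + vector [- cos (2 * r) * (y - p) $ 1 - sin (2 * r) * (y - p) $ 2,
                  - sin (2 * r) * (y - p) $ 1 + cos (2 * r) * (y - p) $ 2]" for r y
  proof -
    have "reflection (mirror r (normal_vec r \<bullet> p)) y $ 1 =
        p $ 1 + (- cos (2 * r) * (y - p) $ 1 - sin (2 * r) * (y - p) $ 2)"
      unfolding cos_double_cos sin_double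
      by (simp add: reflection_mirror inner_normal_vec power2_eq_square algebra_simps)
    moreover have "reflection (mirror r (normal_vec r \<bullet> p)) y $ 2 =
        p $ 2 + (- sin (2 * r) * (y - p) $ 1 + cos (2 * r) * (y - p) $ 2)"
      unfolding cos_double_sin sin_double
      by (simp add: reflection_mirror inner_normal_vec power2_eq_square algebra_simps)
    ultimately show ?thesis
      by (simp add: vec_eq_iff forall_2)
  qed
  show ?thesis
    unfolding R vec_eq_iff forall_2 right_diff_distrib cos_diff sin_diff
    by (simp add: algebra_simps)
qed

text \<open>In a parallel pencil the product is a translation by twice the difference of offsets, in
  a concurrent one a rotation by twice the difference of angles. The line \<open>d\<close> is chosen
  to preserve this difference.\<close>

lemma three_reflections:
  assumes "pencil P" "a \<in> P" "b \<in> P" "c \<in> P"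
  obtains d where "d \<in> P" "reflection a \<circ> reflection b = reflection c \<circ> reflection d"
  using assms(1)
proof (cases rule: pencil_cases)
  case (parallel t)
  obtain i j k where abc: "a = mirror t i" "b = mirror t j" "c = mirror t k"
    using assms parallel by auto
  have "reflection a \<circ> reflection b = reflection c \<circ> reflection (mirror t (k - i + j))"
    by (simp add: abc fun_eq_iff vec_eq_iff reflection_mirror inner_diff_right algebra_simps)
  then show ?thesis
    using that parallel by blast
next
  case (concurrent p)
  have "\<exists>t. l = mirror t (normal_vec t \<bullet> p)" if "l \<in> P" for l
    using that unfolding concurrent by (auto simp: mirror_def elim!: lines_mirrorE)
  then obtain r s t where abc: "a = mirror r (normal_vec r \<bullet> p)"
      "b = mirror s (normal_vec s \<bullet> p)" "c = mirror t (normal_vec t \<bullet> p)"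
    using assms by metis
  define u where "u = t - r + s"
  have "t - u = r - s"
    by (simp add: u_def)
  then have "reflection a \<circ> reflection b =
      reflection c \<circ> reflection (mirror u (normal_vec u \<bullet> p))"
    by (simp add: abc fun_eq_iff mirror_concurrent_comp)
  moreover have "mirror u (normal_vec u \<bullet> p) \<in> P"
    by (simp add: concurrent mem_mirror_iff)
  ultimately show ?thesis
    using that by blast
qed

lemma reflection_comp_inverse:
  assumes "{a, b, c, d} \<subseteq> lines" "reflection a \<circ> reflection b = reflection c \<circ> reflection d"
  shows "reflection b \<circ> reflection a = reflection d \<circ> reflection c"
proof
  fix x
  \<comment> \<open>The inserted product of the reflections in \<open>c\<close>, \<open>d\<close>,
    \<open>d\<close>, \<open>c\<close> is the identity; its inner part can then be rewritten by the
    hypothesis.\<close>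
  have "reflection b (reflection a x) =
      reflection b (reflection a (reflection c (reflection d (reflection d (reflection c x)))))"
    using assms(1) by simp
  also have "reflection c (reflection d (reflection d (reflection c x))) =
      reflection a (reflection b (reflection d (reflection c x)))"
    using fun_cong[OF assms(2)] by simp
  finally show "(reflection b \<circ> reflection a) x = (reflection d \<circ> reflection c) x"
    using assms(1) by simp
qed

section \<open>Groups satisfying the pencil and involution relations\<close>

text \<open>The reduction is carried out in any group that satisfies the relations, so that no
  derivation in the free group is needed; the instance used later is a quotient of
  \<open>line_group\<close>.\<close>

locale pencil_group = group H for H (structure) +
  fixes h :: "plane set \<Rightarrow> 'a"
  assumes closed: "l \<in> lines \<Longrightarrow> h l \<in> carrier H"
    and involution: "l \<in> lines \<Longrightarrow> h l \<otimes> h l = \<one>"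
    and pencil_rel: "\<lbrakk>pencil P; {l, m, l', m'} \<subseteq> P;
      reflection m \<circ> reflection l = reflection m' \<circ> reflection l'\<rbrakk>
      \<Longrightarrow> h m \<otimes> h l = h m' \<otimes> h l'"
begin

definition eval_word :: "plane set list \<Rightarrow> 'a" where
  "eval_word ls = foldr (\<lambda>l w. h l \<otimes> w) ls \<one>"

definition isometry_of :: "plane set list \<Rightarrow> plane \<Rightarrow> plane" where
  "isometry_of ls = foldr (\<lambda>l f. reflection l \<circ> f) ls id"

text \<open>Rewriting must preserve the value in \<open>H\<close>, which is the goal, and also the
  isometry, which at the end rules out three letters and identifies the two remaining ones.\<close>

definition same_word :: "plane set list \<Rightarrow> plane set list \<Rightarrow> bool" (infix "\<simeq>" 50) where
  "us \<simeq> vs \<longleftrightarrow> eval_word us = eval_word vs \<and> isometry_of us = isometry_of vs"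

lemma eval_word_simps [simp]:
  "eval_word [] = \<one>" "eval_word (l # ls) = h l \<otimes> eval_word ls"
  by (simp_all add: eval_word_def)

lemma isometry_of_simps [simp]:
  "isometry_of [] = id" "isometry_of (l # ls) = reflection l \<circ> isometry_of ls"
  by (simp_all add: isometry_of_def)

lemma eval_word_closed: "set ls \<subseteq> lines \<Longrightarrow> eval_word ls \<in> carrier H"
  by (induction ls) (auto simp: closed)

lemma eval_word_append:
  "\<lbrakk>set us \<subseteq> lines; set vs \<subseteq> lines\<rbrakk> \<Longrightarrow> eval_word (us @ vs) = eval_word us \<otimes> eval_word vs"
  by (induction us) (auto simp: closed eval_word_closed m_assoc)

lemma isometry_of_append: "isometry_of (us @ vs) = isometry_of us \<circ> isometry_of vs"
  by (induction us) (auto simp: comp_assoc)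

lemma same_word_trans [trans]: "us \<simeq> vs \<Longrightarrow> vs \<simeq> ws \<Longrightarrow> us \<simeq> ws"
  by (simp add: same_word_def)

lemma same_word_subst:
  assumes "us \<simeq> us'" "set (xs @ us @ us' @ ys) \<subseteq> lines"
  shows "xs @ us @ ys \<simeq> xs @ us' @ ys"
  using assms by (simp add: same_word_def eval_word_append isometry_of_append)

lemma same_word_involution: "l \<in> lines \<Longrightarrow> [l, l] \<simeq> []"
  by (simp add: same_word_def closed involution reflection_involution)

lemma same_word_pencil:
  assumes "pencil P" "{a, b, c, d} \<subseteq> P"
    and "reflection a \<circ> reflection b = reflection c \<circ> reflection d"
  shows "[a, b] \<simeq> [c, d]"
proof -
  have "{a, b, c, d} \<subseteq> lines"
    using assms pencil_subset_lines by blast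
  moreover have "h a \<otimes> h b = h c \<otimes> h d"
    using assms by (intro pencil_rel[of P]) auto
  ultimately show ?thesis
    using assms(3) by (simp add: same_word_def closed)
qed

lemma same_word_pencil_left:
  assumes "pencil P" "a \<in> P" "b \<in> P" "c \<in> P"
  obtains d where "d \<in> P" "[a, b] \<simeq> [c, d]"
proof -
  obtain d where "d \<in> P" "reflection a \<circ> reflection b = reflection c \<circ> reflection d"
    by (rule three_reflections[OF assms])
  then show thesis
    using assms by (intro that[of d] same_word_pencil[OF assms(1)]) auto
qed

lemma same_word_pencil_right:
  assumes "pencil P" "a \<in> P" "b \<in> P" "c \<in> P"
  obtains d where "d \<in> P" "[a, b] \<simeq> [d, c]"
proof -
  obtain d where d: "d \<in> P" "reflection b \<circ> reflection a = reflection c \<circ> reflection d"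
    by (rule three_reflections[OF assms(1,3,2,4)])
  have "reflection a \<circ> reflection b = reflection d \<circ> reflection c"
    using assms pencil_subset_lines[OF assms(1)] d(1)
    by (intro reflection_comp_inverse[OF _ d(2)]) auto
  then show thesis
    using d assms by (intro that[of d] same_word_pencil[OF assms(1)]) auto
qed

section \<open>Shortening words\<close>

lemma four_to_two_common_line:
  assumes "pencil P" "a \<in> P" "b \<in> P" "pencil Q" "c \<in> Q" "d \<in> Q" "e \<in> P" "e \<in> Q"
  shows "\<exists>x\<in>lines. \<exists>y\<in>lines. [a, b, c, d] \<simeq> [x, y]"
proof -
  obtain x where x: "x \<in> P" "[a, b] \<simeq> [x, e]"
    using same_word_pencil_right assms by blast
  obtain y where y: "y \<in> Q" "[c, d] \<simeq> [e, y]"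
    using same_word_pencil_left assms by blast
  have L: "{a, b, c, d, e, x, y} \<subseteq> lines"
    using assms x y pencil_subset_lines by blast
  have "[a, b, c, d] \<simeq> [x, e, c, d]"
    using same_word_subst[OF x(2), of "[]" "[c, d]"] L by simp
  also have "\<dots> \<simeq> [x, e, e, y]"
    using same_word_subst[OF y(2), of "[x, e]" "[]"] L by simp
  also have "\<dots> \<simeq> [x, y]"
    using same_word_subst[OF same_word_involution, of e "[x]" "[y]"] L by simp
  finally show ?thesis
    using L by blast
qed

text \<open>Any pencil containing \<open>c\<close> and \<open>d\<close> has a line through
  \<open>p\<close>, which it therefore shares with the pencil at \<open>p\<close> containing
  \<open>a\<close> and \<open>b\<close>.\<close>

lemma four_to_two_meet:
  assumes "{a, b, c, d} \<subseteq> lines" "p \<in> a" "p \<in> b"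
  shows "\<exists>x\<in>lines. \<exists>y\<in>lines. [a, b, c, d] \<simeq> [x, y]"
proof -
  have "c \<in> lines" "d \<in> lines"
    using assms by auto
  then obtain Q where Q: "pencil Q" "c \<in> Q" "d \<in> Q"
    by (rule two_lines_in_pencil)
  obtain e where "e \<in> Q" "p \<in> e"
    by (rule pencil_through[OF Q(1)])
  then show ?thesis
    using pencil_subset_lines[OF Q(1)] assms
    by (intro four_to_two_common_line[OF pencil_concurrent[of p] _ _ Q]) auto
qed

text \<open>In the remaining case \<open>a \<parallel> b\<close>, \<open>c \<parallel> d\<close> with distinct directions, rewriting the middle pair
  \<open>b c\<close> as \<open>c e\<close> makes the first two lines meet.\<close>

lemma four_to_two:
  assumes L: "{a, b, c, d} \<subseteq> lines"
  shows "\<exists>x\<in>lines. \<exists>y\<in>lines. [a, b, c, d] \<simeq> [x, y]"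
proof -
  have lines: "a \<in> lines" "b \<in> lines" "c \<in> lines" "d \<in> lines"
    using L by auto
  consider (meet) p where "p \<in> a" "p \<in> b"
    | (parallel) t where "a \<in> range (mirror t)" "b \<in> range (mirror t)"
    using lines(1,2) by (rule lines_meet_or_parallel)
  then show ?thesis
  proof cases
    case (meet p)
    with L show ?thesis
      by (rule four_to_two_meet)
  next
    case (parallel t)
    show ?thesis
    proof (cases "c \<in> range (mirror t)")
      case True
      \<comment> \<open>Here \<open>c\<close> itself is the common line of the two pencils.\<close>
      obtain Q where "pencil Q" "c \<in> Q" "d \<in> Q"
        using lines(3,4) by (rule two_lines_in_pencil)
      then show ?thesis
        using parallel True by (intro four_to_two_common_line[OF pencil_parallel[of t]])
    next
      case False
      obtain s k where c: "c = mirror s k"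
        using lines(3) by (rule lines_mirrorE)
      have meets: "\<exists>p. p \<in> l \<and> p \<in> c" if "l \<in> range (mirror t)" for l
      proof -
        from that obtain j where "l = mirror t j"
          by blast
        then show ?thesis
          using mirror_meet_or_parallel[of t j s k] False unfolding c by (metis rangeI)
      qed
      obtain p where "p \<in> b" "p \<in> c"
        using meets parallel by blast
      then have bc: "b \<in> {l \<in> lines. p \<in> l}" "c \<in> {l \<in> lines. p \<in> l}"
        using lines by auto
      \<comment> \<open>Prescribing \<open>c\<close> as the new first letter moves it next to
        \<open>a\<close>, which it meets as well.\<close>
      obtain e where "e \<in> {l \<in> lines. p \<in> l}" "[b, c] \<simeq> [c, e]"
        by (rule same_word_pencil_left[OF pencil_concurrent bc bc(2)])
      then have e: "e \<in> lines" "[b, c] \<simeq> [c, e]"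
        by auto
      have "[a, b, c, d] \<simeq> [a, c, e, d]"
        using same_word_subst[OF e(2), of "[a]" "[d]"] L e(1) by simp
      moreover obtain q where "q \<in> a" "q \<in> c"
        using meets parallel by blast
      then have "\<exists>x\<in>lines. \<exists>y\<in>lines. [a, c, e, d] \<simeq> [x, y]"
        using L e(1) by (intro four_to_two_meet) auto
      ultimately show ?thesis
        by (meson same_word_trans)
    qed
  qed
qed

text \<open>A letter put before two gives three, and a letter put before three gives four, which
  shrink to two. Padding the empty word with a repeated line lets the induction start at length
  two.\<close>

lemma word_reduce:
  assumes "set ls \<subseteq> lines"
  shows "\<exists>a\<in>lines. \<exists>b\<in>lines. ls \<simeq> [a, b] \<or> (\<exists>c\<in>lines. ls \<simeq> [a, b, c])"
  using assms
proof (induction ls)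
  case Nil
  have "[] \<simeq> [mirror 0 0, mirror 0 0]"
    using same_word_involution[of "mirror 0 0"] by (simp add: same_word_def)
  then show ?case
    using mirror_in_lines by blast
next
  case (Cons l ls)
  have cons: "l # ls \<simeq> l # us" if "ls \<simeq> us" for us
    using that by (simp add: same_word_def)
  obtain a b where ab: "a \<in> lines" "b \<in> lines"
    "ls \<simeq> [a, b] \<or> (\<exists>c\<in>lines. ls \<simeq> [a, b, c])"
    using Cons by auto
  from ab(3) show ?case
  proof
    assume "ls \<simeq> [a, b]"
    then show ?thesis
      using cons[of "[a, b]"] ab(1,2) Cons.prems by auto
  next
    assume "\<exists>c\<in>lines. ls \<simeq> [a, b, c]"
    then obtain c where c: "c \<in> lines" "l # ls \<simeq> [l, a, b, c]"
      using cons by blast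
    obtain x y where "x \<in> lines" "y \<in> lines" "[l, a, b, c] \<simeq> [x, y]"
      using four_to_two[of l a b c] c ab Cons.prems by auto
    then show ?thesis
      using c(2) by (meson same_word_trans)
  qed
qed

lemma eval_word_eq_one:
  assumes "set ls \<subseteq> lines" "isometry_of ls = id"
  shows "eval_word ls = \<one>"
proof -
  have iso: "isometry_of us x = x" if "ls \<simeq> us" for us x
    using that assms(2) by (metis id_apply same_word_def)
  \<comment> \<open>Multiplying by the reflection in \<open>c\<close> on the right would make a
    product of two reflections a reflection.\<close>
  have False if "a \<in> lines" "b \<in> lines" "c \<in> lines" "ls \<simeq> [a, b, c]" for a b c
  proof -
    have "reflection a (reflection b (reflection c x)) = x" for x
      using iso[OF that(4), of x] by simp
    then have "reflection a \<circ> reflection b = reflection c"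
      using that(3) by (metis (no_types, lifting) comp_apply ext reflection_reflection)
    then show False
      using reflection_comp_neq_reflection that by blast
  qed
  then obtain a b where ab: "a \<in> lines" "b \<in> lines" "ls \<simeq> [a, b]"
    using word_reduce[OF assms(1)] by blast
  have "reflection a (reflection b x) = x" for x
    using iso[OF ab(3), of x] by simp
  then have "reflection a = reflection b"
    using ab(1) by (metis ext reflection_reflection)
  then have "a = b"
    using reflection_inj ab by blast
  then show ?thesis
    using ab same_word_involution[of a] by (simp add: same_word_def)
qed

end

section \<open>Passage to quotients of the free group\<close>

text \<open>A relator lying in \<open>N\<close> means that the two sides of its relation have the
  same coset, so the relations hold in the quotient.\<close>

lemma pencil_group_quotient:
  assumes "N \<lhd> line_group" "involution_relators \<union> pencil_relators \<subseteq> N"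
  shows "pencil_group (line_group Mod N) (\<lambda>l. N #>\<^bsub>line_group\<^esub> sym_of l)"
proof -
  interpret N: normal N line_group by fact
  interpret Q: group "line_group Mod N" by (rule N.factorgroup_is_group)
  show ?thesis
  proof
    fix l assume l: "l \<in> lines"
    show "N #>\<^bsub>line_group\<^esub> sym_of l \<in> carrier (line_group Mod N)"
      using free_gen_closed[OF l] by (auto simp: FactGroup_def RCOSETS_def)
    have "sym_of l \<otimes>\<^bsub>line_group\<^esub> sym_of l \<in> N"
      using l assms(2) by (auto simp: involution_relators_def)
    then show "(N #>\<^bsub>line_group\<^esub> sym_of l) \<otimes>\<^bsub>line_group Mod N\<^esub> (N #>\<^bsub>line_group\<^esub> sym_of l) =
        \<one>\<^bsub>line_group Mod N\<^esub>"
      using l by (simp add: N.rcos_sum N.rcos_const free_gen_closed)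
  next
    fix P l m l' m'
    assume P: "pencil P" "{l, m, l', m'} \<subseteq> P"
      and eq: "reflection m \<circ> reflection l = reflection m' \<circ> reflection l'"
    have L: "l \<in> lines" "m \<in> lines" "l' \<in> lines" "m' \<in> lines"
      using P pencil_subset_lines by auto
    have "(sym_of m \<otimes>\<^bsub>line_group\<^esub> sym_of l) \<otimes>\<^bsub>line_group\<^esub>
        inv\<^bsub>line_group\<^esub> (sym_of m' \<otimes>\<^bsub>line_group\<^esub> sym_of l') \<in> pencil_relators"
      unfolding pencil_relators_def mem_Collect_eq
      by (rule exI[of _ l], rule exI[of _ m], rule exI[of _ l'], rule exI[of _ m'])
         (use P eq in auto)
    then have "sym_of m \<otimes>\<^bsub>line_group\<^esub> sym_of l \<in>
      N #>\<^bsub>line_group\<^esub> (sym_of m' \<otimes>\<^bsub>line_group\<^esub> sym_of l')"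
      using L assms(2) by (intro N.rcos_module_rev) (auto simp: free_gen_closed N.is_group)
    then have "N #>\<^bsub>line_group\<^esub> (sym_of m' \<otimes>\<^bsub>line_group\<^esub> sym_of l') =
        N #>\<^bsub>line_group\<^esub> (sym_of m \<otimes>\<^bsub>line_group\<^esub> sym_of l)"
      using L N.subgroup_axioms by (intro N.repr_independence) (simp_all add: free_gen_closed)
    then show "(N #>\<^bsub>line_group\<^esub> sym_of m) \<otimes>\<^bsub>line_group Mod N\<^esub> (N #>\<^bsub>line_group\<^esub> sym_of l) =
        (N #>\<^bsub>line_group\<^esub> sym_of m') \<otimes>\<^bsub>line_group Mod N\<^esub> (N #>\<^bsub>line_group\<^esub> sym_of l')"
      using L by (simp add: N.rcos_sum free_gen_closed)
  qed
qed

theorem theorem2: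
  fixes ls :: "plane set list"
  assumes "set ls \<subseteq> lines"
    and "foldr (\<lambda>l f. reflection l \<circ> f) ls id = id"
  shows "word_of ls \<in> normal_closure line_group (involution_relators \<union> pencil_relators)"
  unfolding normal_closure_def
proof safe
  \<comment> \<open>The normal closure is an intersection, so each normal \<open>N\<close>
    containing the relators is treated separately, through its quotient.\<close>
  fix N assume N: "N \<lhd> line_group" "involution_relators \<union> pencil_relators \<subseteq> N"
  interpret N: normal N line_group by fact
  interpret Q: pencil_group "line_group Mod N" "\<lambda>l. N #>\<^bsub>line_group\<^esub> sym_of l"
    using N by (rule pencil_group_quotient)
  have word_simps: "word_of [] = \<one>\<^bsub>line_group\<^esub>"
      "word_of (l # us) = sym_of l \<otimes>\<^bsub>line_group\<^esub> word_of us" for l us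
    by (simp_all add: word_of_def)
  have closed: "word_of us \<in> carrier line_group" if "set us \<subseteq> lines" for us
    using that by (induction us) (auto simp: word_simps free_gen_closed)
  have "Q.eval_word us = N #>\<^bsub>line_group\<^esub> word_of us" if "set us \<subseteq> lines" for us
    using that
    by (induction us) (simp_all add: word_simps N.rcos_sum free_gen_closed closed N.subset)
  \<comment> \<open>The word evaluates to the identity of the quotient, which is the coset
    \<open>N\<close> itself.\<close>
  then have "N #>\<^bsub>line_group\<^esub> word_of ls = N"
    using Q.eval_word_eq_one assms by (simp add: Q.isometry_of_def)
  then show "word_of ls \<in> N"
    using N.rcos_self[OF closed[OF assms(1)] N.subgroup_axioms] by simp
qed

end
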